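(* Suppose that a probability measure $\mu$ on $\mathbb{R}^n$ is $\alpha$-regular and satisfies $\mathrm{CI}(\beta)$. Then for any norm $\|\cdot\|$ on $\mathbb{R}^n$ and any $p\ge2$, $$\Big(\int\big|\|x\|-\mathrm{Med}_\mu(\|x\|)\big|^pd\mu\Big)^{1/p}\le2\alpha\beta\sup_{\|u\|_*\le1}\Big(\int|\langle u,x\rangle|^pd\mu\Big)^{1/p},$$ where $\|\cdot\|_*$ denotes the norm dual to $\|\cdot\|$.
   Context: $\mathrm{Med}_\mu(\|x\|)$ is a median of the function $x\mapsto\|x\|$ with respect to $\mu$. $\mu$ is $\alpha$-regular if for all $p\ge q\ge2$ and $v\in\mathbb{R}^n$, $(\int|\langle v,x\rangle|^pd\mu)^{1/p}\le\alpha\frac pq(\int|\langle v,x\rangle|^qd\mu)^{1/q}$. For $p\ge1$ let $\mathcal{Z}_p(\mu)=\{x\in\mathbb{R}^n: |\langle v,x\rangle|^p\le\int|\langle v,y\rangle|^pd\mu(y)\text{ for all }v\in\mathbb{R}^n\}$. $\mu$ satisfies $\mathrm{CI}(\beta)$, $\beta>0$, if for all $p\ge2$ and all Borel $A$ with $\mu(A)\ge\frac12$ one has $1-\mu(A+\beta\mathcal{Z}_p(\mu))\le e^{-p}(1-\mu(A))$. *)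

theory Defs
  imports "HOL-Analysis.Analysis" "HOL-Probability.Probability_Measure"
begin

text \<open>Integrals of powers are taken in \<open>[0,\<infinity>]\<close> (type \<^typ>\<open>ennreal\<close>), so that no finiteness of moments
  has to be assumed: the Bochner integral of a non-integrable function would be \<open>0\<close>.
  \<open>ennreal_pow x r\<close> is the power with positive exponent \<open>r\<close>, with \<open>\<infinity>^r = \<infinity>\<close>.\<close>

definition ennreal_pow :: "ennreal \<Rightarrow> real \<Rightarrow> ennreal" where
  "ennreal_pow x r = (if x = top then top else ennreal (enn2real x powr r))"

definition Lp_size :: "'a measure \<Rightarrow> real \<Rightarrow> ('a \<Rightarrow> real) \<Rightarrow> ennreal" where
  "Lp_size M p f = ennreal_pow (\<integral>\<^sup>+ x. ennreal (\<bar>f x\<bar> powr p) \<partial>M) (1 / p)"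

definition is_median :: "'a measure \<Rightarrow> ('a \<Rightarrow> real) \<Rightarrow> real \<Rightarrow> bool" where
  "is_median M f m \<longleftrightarrow>
     measure M {x \<in> space M. f x \<le> m} \<ge> 1 / 2 \<and> measure M {x \<in> space M. f x \<ge> m} \<ge> 1 / 2"

text \<open>The coefficient \<open>ennreal (\<alpha> * (p / q))\<close> is \<open>0\<close> for \<open>\<alpha> < 0\<close>. This does not change the notion:
  applied with \<open>p = q\<close>, a nonpositive \<open>\<alpha>\<close> is admissible exactly if all moments vanish, whether or not
  it is truncated.\<close>

definition regular_measure :: "real \<Rightarrow> (real ^ 'n) measure \<Rightarrow> bool" where
  "regular_measure \<alpha> \<mu> \<longleftrightarrow>
     (\<forall>p q. \<forall>v :: real ^ 'n. p \<ge> q \<and> q \<ge> 2 \<longrightarrow>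
        Lp_size \<mu> p (\<lambda>x. v \<bullet> x) \<le> ennreal (\<alpha> * (p / q)) * Lp_size \<mu> q (\<lambda>x. v \<bullet> x))"

definition Z_body :: "real \<Rightarrow> (real ^ 'n) measure \<Rightarrow> (real ^ 'n) set" where
  "Z_body p \<mu> =
     {x. \<forall>v. ennreal (\<bar>v \<bullet> x\<bar> powr p) \<le> (\<integral>\<^sup>+ y. ennreal (\<bar>v \<bullet> y\<bar> powr p) \<partial>\<mu>)}"

text \<open>The Minkowski sum of a Borel set and a closed convex set is analytic but in general not Borel,
  whereas \<^const>\<open>measure\<close> is \<open>0\<close> on sets outside the \<open>\<sigma>\<close>-algebra. Analytic sets are measurable for the
  completion of a Borel probability measure, so the measure of the sum is taken there.\<close>

definition CI :: "real \<Rightarrow> (real ^ 'n) measure \<Rightarrow> bool" where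
  "CI \<beta> \<mu> \<longleftrightarrow>
     \<beta> > 0 \<and>
     (\<forall>p \<ge> 2. \<forall>A \<in> sets borel. measure \<mu> A \<ge> 1 / 2 \<longrightarrow>
        1 - measure (completion \<mu>) {a + \<beta> *\<^sub>R z | a z. a \<in> A \<and> z \<in> Z_body p \<mu>}
          \<le> exp (- p) * (1 - measure \<mu> A))"

definition is_norm :: "('a::real_vector \<Rightarrow> real) \<Rightarrow> bool" where
  "is_norm N \<longleftrightarrow>
     (\<forall>x. N x = 0 \<longleftrightarrow> x = 0) \<and>
     (\<forall>c x. N (c *\<^sub>R x) = \<bar>c\<bar> * N x) \<and>
     (\<forall>x y. N (x + y) \<le> N x + N y)"

definition dual_norm :: "('a::real_inner \<Rightarrow> real) \<Rightarrow> 'a \<Rightarrow> real" where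
  "dual_norm N u = (SUP x\<in>{x. N x \<le> 1}. \<bar>u \<bullet> x\<bar>)"

end

theory Submission
  imports Defs
begin

text \<open>
  Write \<open>w q\<close> for the weak \<open>q\<close>-th moment, the supremum of the \<open>L\<^sub>q\<close>-sizes of the functionals \<open>u \<bullet> x\<close>
  over the dual unit ball. By Hahn--Banach duality the body \<open>Z_q\<close> lies in the \<open>N\<close>-ball of radius \<open>w q\<close>
  (\<open>norm_le_on_Z_body\<close>), so adding \<open>\<beta> Z_q\<close> to a set changes \<open>N\<close> by at most \<open>\<beta> w q\<close>. Enlarging the two
  half-measure sets \<open>N \<le> m\<close> and \<open>N \<ge> m\<close> in this way, \<open>CI\<close> shows that \<open>N\<close> deviates from its
  median by more than \<open>\<beta> w q\<close> with probability at most \<open>exp (- q)\<close> (\<open>CI_deviation\<close>).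

  Regularity says that \<open>w q\<close> grows at most linearly, \<open>w q \<le> \<alpha> (q / p) w p\<close> for \<open>q \<ge> p\<close>. Hence
  \<open>\<bar>N x - m\<bar>\<close> has an exponential tail beyond the level \<open>c p\<close> with scale \<open>c = \<alpha> \<beta> w p / p\<close>, and a
  variable with such a tail has \<open>L\<^sub>p\<close>-size at most \<open>2 p c = 2 \<alpha> \<beta> w p\<close>
  (\<open>Lp_size_le_of_exponential_tail\<close>). The last bound comes from majorizing
  \<open>x powr p\<close> by the multiple of \<open>exp (x / 2)\<close> that touches it at \<open>x = 2 p\<close>; this is the origin of the
  constant \<open>2\<close>.
\<close>

section \<open>Norms on Euclidean space and duality\<close>

lemma is_norm_nonneg:
  assumes "is_norm N" shows "0 \<le> N x"
proof -
  have "N (x + - x) \<le> N x + N (- x)" "N (- x) = N x" "N 0 = 0"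
    using assms unfolding is_norm_def
    by (blast, metis abs_minus_cancel abs_one mult_1 scaleR_minus1_left, blast)
  then show ?thesis by simp
qed

lemma is_norm_scaleR: "is_norm N \<Longrightarrow> N (c *\<^sub>R x) = \<bar>c\<bar> * N x"
  by (simp add: is_norm_def)

lemma is_norm_triangle: "is_norm N \<Longrightarrow> N (x + y) \<le> N x + N y"
  by (simp add: is_norm_def)

lemma is_norm_convex:
  assumes "is_norm N" shows "convex_on UNIV N"
proof (rule convex_onI)
  fix t :: real and x y
  assume "0 < t" "t < 1"
  then show "N ((1 - t) *\<^sub>R x + t *\<^sub>R y) \<le> (1 - t) * N x + t * N y"
    using is_norm_triangle[OF assms, of "(1 - t) *\<^sub>R x" "t *\<^sub>R y"]
    by (simp add: is_norm_scaleR[OF assms])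
qed simp

lemma is_norm_continuous_on:
  fixes N :: "'a::euclidean_space \<Rightarrow> real"
  assumes "is_norm N" shows "continuous_on UNIV N"
  using convex_on_continuous[OF open_UNIV is_norm_convex[OF assms]] .

text \<open>This is the half of \<open>N z = sup {u \<bullet> z | dual_norm N u \<le> 1}\<close> that needs Hahn--Banach. A hyperplane
  separating \<open>z\<close> from the ball of radius \<open>r\<close> is rescaled to a functional whose modulus is at most \<open>r\<close>
  on that ball. Letting \<open>r\<close> increase to \<open>N z\<close> recovers the supremum.\<close>

lemma dual_norm_separation:
  fixes N :: "'a::euclidean_space \<Rightarrow> real"
  assumes N: "is_norm N" and r: "0 < r" "r < N z"
  shows "\<exists>u. dual_norm N u \<le> 1 \<and> r < u \<bullet> z"
proof -
  let ?S = "{x. N x \<le> r}"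
  have "convex ?S"
  proof (rule convexI)
    fix x y and a b :: real
    assume *: "x \<in> ?S" "y \<in> ?S" "0 \<le> a" "0 \<le> b" "a + b = 1"
    have "N (a *\<^sub>R x + b *\<^sub>R y) \<le> a * N x + b * N y"
      using is_norm_triangle[OF N, of "a *\<^sub>R x" "b *\<^sub>R y"] * by (simp add: is_norm_scaleR[OF N])
    also have "\<dots> \<le> a * r + b * r" using * by (intro add_mono mult_left_mono) auto
    also have "\<dots> = r" using * by (simp flip: distrib_right)
    finally show "a *\<^sub>R x + b *\<^sub>R y \<in> ?S" by simp
  qed
  moreover have "closed ?S"
    using is_norm_continuous_on[OF N] by (intro closed_Collect_le) auto
  ultimately obtain a b where ab: "a \<bullet> z < b" "\<And>x. x \<in> ?S \<Longrightarrow> b < a \<bullet> x"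
    using separating_hyperplane_closed_point[of ?S z] r by auto
  have N0: "N 0 = 0" using N by (simp add: is_norm_def)
  have b: "b < 0" using ab(2)[of 0] N0 r by simp
  \<comment> \<open>The sign of \<open>b\<close> flips the inequalities: \<open>a / b\<close> is below \<open>1\<close> on the ball and above \<open>1\<close> at \<open>z\<close>.\<close>
  define u where "u = (r / b) *\<^sub>R a"
  have "\<bar>u \<bullet> x\<bar> \<le> 1" if x: "N x \<le> 1" for x
  proof -
    have "N (r *\<^sub>R x) \<le> r" "N ((- r) *\<^sub>R x) \<le> r"
      using x r unfolding is_norm_scaleR[OF N] by (simp_all add: mult_left_le)
    then have "b < r * (a \<bullet> x)" "b < - (r * (a \<bullet> x))"
      using ab(2)[of "r *\<^sub>R x"] ab(2)[of "(- r) *\<^sub>R x"] by auto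
    then have "\<bar>r * (a \<bullet> x)\<bar> \<le> \<bar>b\<bar>" using b by linarith
    moreover have "\<bar>u \<bullet> x\<bar> = \<bar>r * (a \<bullet> x)\<bar> / \<bar>b\<bar>"
      by (simp add: u_def abs_mult abs_divide)
    ultimately show ?thesis using b by (metis abs_ge_zero divide_le_eq_1 order_le_less)
  qed
  moreover have "{x. N x \<le> 1} \<noteq> {}" using N0 by (auto intro!: exI[of _ 0])
  ultimately have "dual_norm N u \<le> 1"
    unfolding dual_norm_def by (intro cSUP_least) auto
  moreover have "r < u \<bullet> z"
    using mult_strict_left_mono[OF ab(1) r(1)] b by (simp add: u_def less_divide_eq)
  ultimately show ?thesis by blast
qed

section \<open>The norm on the bodies \<open>Z_q\<close>\<close>

lemma Lp_size_leI:
  assumes "(\<integral>\<^sup>+ x. ennreal (\<bar>f x\<bar> powr p) \<partial>M) \<le> ennreal (c powr p)" "0 \<le> c" "0 < p"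
  shows "Lp_size M p f \<le> ennreal c"
proof -
  let ?I = "\<integral>\<^sup>+ x. ennreal (\<bar>f x\<bar> powr p) \<partial>M"
  have fin: "?I \<noteq> top" using assms(1) by (metis ennreal_neq_top neq_top_trans)
  then have "enn2real ?I \<le> c powr p"
    using assms(1) by (intro enn2real_leI) auto
  then have "enn2real ?I powr (1 / p) \<le> (c powr p) powr (1 / p)"
    using assms by (intro powr_mono2) auto
  also have "\<dots> = c" using assms by (simp add: powr_powr)
  finally show ?thesis
    using fin by (simp add: Lp_size_def ennreal_pow_def ennreal_leI)
qed

lemma le_Lp_sizeI:
  assumes "ennreal (c powr p) \<le> (\<integral>\<^sup>+ x. ennreal (\<bar>f x\<bar> powr p) \<partial>M)" "0 \<le> c" "0 < p"
  shows "ennreal c \<le> Lp_size M p f"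
proof (cases "(\<integral>\<^sup>+ x. ennreal (\<bar>f x\<bar> powr p) \<partial>M) = top")
  case False
  let ?I = "\<integral>\<^sup>+ x. ennreal (\<bar>f x\<bar> powr p) \<partial>M"
  have "c powr p \<le> enn2real ?I"
    using assms(1) False by (metis enn2real_ennreal enn2real_mono powr_ge_zero top.not_eq_extremum)
  then have "(c powr p) powr (1 / p) \<le> enn2real ?I powr (1 / p)"
    using assms by (intro powr_mono2) auto
  moreover have "(c powr p) powr (1 / p) = c" using assms by (simp add: powr_powr)
  ultimately show ?thesis
    using False by (simp add: Lp_size_def ennreal_pow_def ennreal_leI)
qed (simp add: Lp_size_def ennreal_pow_def)

text \<open>Points of \<open>Z_q\<close> are those at which every functional is bounded by its own \<open>L\<^sub>q\<close>-size; taking the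
  supremum over the dual ball turns the left-hand side into the norm.\<close>

lemma norm_le_on_Z_body:
  fixes \<mu> :: "(real ^ 'n) measure"
  assumes N: "is_norm N" and q: "0 < q" and z: "z \<in> Z_body q \<mu>"
  shows "ennreal (N z) \<le> (SUP u\<in>{u. dual_norm N u \<le> 1}. Lp_size \<mu> q (\<lambda>x. u \<bullet> x))"
    (is "_ \<le> ?s")
proof (rule ccontr)
  assume "\<not> ?thesis"
  then have less: "?s < ennreal (N z)" by simp
  then obtain t where t: "?s = ennreal t" "0 \<le> t" by (cases ?s) auto
  with less have "t < N z" using is_norm_nonneg[OF N] by (simp add: ennreal_less_iff)
  then have "0 < (t + N z) / 2" "(t + N z) / 2 < N z" using t by auto
  then obtain u where u: "dual_norm N u \<le> 1" "(t + N z) / 2 < u \<bullet> z"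
    using dual_norm_separation[OF N] by blast
  have "ennreal \<bar>u \<bullet> z\<bar> \<le> Lp_size \<mu> q (\<lambda>x. u \<bullet> x)"
    using z q by (intro le_Lp_sizeI) (auto simp: Z_body_def)
  also have "\<dots> \<le> ennreal t" unfolding t(1)[symmetric] using u by (intro SUP_upper) auto
  finally show False using u t \<open>t < N z\<close> by simp
qed

section \<open>Concentration of the norm around its median\<close>

text \<open>This passes from the Minkowski sum in \<open>CI\<close> to a Borel superset. There are two cases: if \<open>S\<close> is
  measurable for the completion, this is monotonicity, and otherwise the left-hand side is \<open>0\<close> by
  convention.\<close>

lemma measure_completion_le:
  assumes "prob_space M" "B \<in> sets M" "S \<subseteq> B"
  shows "measure (completion M) S \<le> measure M B"
proof (cases "S \<in> sets (completion M)")
  case True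
  interpret prob_space "completion M" using assms(1) by (rule prob_space.prob_space_completion)
  have "measure (completion M) S \<le> measure (completion M) B"
    using assms by (intro finite_measure_mono) auto
  then show ?thesis using assms by (simp add: measure_def)
qed (simp add: measure_notin_sets)

text \<open>The enlargement of \<open>N \<le> m\<close> stays in \<open>N \<le> m + t\<close> and that of \<open>N \<ge> m\<close> in \<open>N \<ge> m - t\<close>. Each of the
  two complements has measure at most \<open>exp (- q) / 2\<close>, because the set that was enlarged has measure at
  least one half.\<close>

lemma CI_deviation:
  fixes \<mu> :: "(real ^ 'n) measure"
  assumes \<mu>: "prob_space \<mu>" "sets \<mu> = sets borel" and CI: "CI \<beta> \<mu>"
    and N: "is_norm N" and m: "is_median \<mu> N m" and q: "2 \<le> q"
    and t: "\<And>z. z \<in> Z_body q \<mu> \<Longrightarrow> \<beta> * N z \<le> t"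
  shows "measure \<mu> {x. \<bar>N x - m\<bar> > t} \<le> exp (- q)"
proof -
  interpret prob_space \<mu> by fact
  have sp: "space \<mu> = UNIV" using sets_eq_imp_space_eq[OF \<mu>(2)] by simp
  have [measurable]: "N \<in> borel_measurable \<mu>"
    using borel_measurable_continuous_onI[OF is_norm_continuous_on[OF N]] \<mu>(2)
    by (simp cong: measurable_cong_sets)
  have meas: "{x. P (N x)} \<in> sets \<mu>" if "Measurable.pred borel P" for P
    using that measurable_sets_Collect[of N \<mu> borel P] sp by simp
  have \<beta>: "\<beta> > 0" using CI by (simp add: CI_def)
  have enlarge: "measure \<mu> (- B) \<le> exp (- q) * (1 / 2)"
    if A: "A \<in> sets \<mu>" "measure \<mu> A \<ge> 1 / 2" and B: "B \<in> sets \<mu>"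
      and sub: "\<And>a z. a \<in> A \<Longrightarrow> z \<in> Z_body q \<mu> \<Longrightarrow> a + \<beta> *\<^sub>R z \<in> B" for A B
  proof -
    let ?S = "{a + \<beta> *\<^sub>R z | a z. a \<in> A \<and> z \<in> Z_body q \<mu>}"
    have "measure \<mu> (- B) = 1 - measure \<mu> B"
      using prob_compl[OF B] sp by (simp add: Compl_eq_Diff_UNIV)
    also have "\<dots> \<le> 1 - measure (completion \<mu>) ?S"
      using measure_completion_le[OF \<mu>(1) B, of ?S] sub by auto
    also have "\<dots> \<le> exp (- q) * (1 - measure \<mu> A)"
      using CI q A \<mu>(2) unfolding CI_def by blast
    also have "\<dots> \<le> exp (- q) * (1 / 2)" using A by simp
    finally show ?thesis .
  qed
  have step: "N (\<beta> *\<^sub>R z) \<le> t" if "z \<in> Z_body q \<mu>" for z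
    using t[OF that] \<beta> by (simp add: is_norm_scaleR[OF N])
  have "measure \<mu> (- {x. N x \<le> m + t}) \<le> exp (- q) * (1 / 2)"
  proof (rule enlarge[of "{x. N x \<le> m}"])
    fix a z assume "a \<in> {x. N x \<le> m}" "z \<in> Z_body q \<mu>"
    then show "a + \<beta> *\<^sub>R z \<in> {x. N x \<le> m + t}"
      using is_norm_triangle[OF N, of a "\<beta> *\<^sub>R z"] step[of z] by auto
  qed (use m sp in \<open>auto simp: is_median_def intro!: meas\<close>)
  moreover have "measure \<mu> (- {x. m - t \<le> N x}) \<le> exp (- q) * (1 / 2)"
  proof (rule enlarge[of "{x. m \<le> N x}"])
    fix a z assume *: "a \<in> {x. m \<le> N x}" "z \<in> Z_body q \<mu>"
    have "N a \<le> N (a + \<beta> *\<^sub>R z) + N (\<beta> *\<^sub>R z)"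
      using is_norm_triangle[OF N, of "a + \<beta> *\<^sub>R z" "(- 1) *\<^sub>R (\<beta> *\<^sub>R z)"]
      unfolding is_norm_scaleR[OF N, of "- 1"] by simp
    then show "a + \<beta> *\<^sub>R z \<in> {x. m - t \<le> N x}"
      using step[of z] * by auto
  qed (use m sp in \<open>auto simp: is_median_def intro!: meas\<close>)
  moreover have "measure \<mu> {x. \<bar>N x - m\<bar> > t}
      \<le> measure \<mu> (- {x. N x \<le> m + t}) + measure \<mu> (- {x. m - t \<le> N x})"
  proof -
    have ms: "- {x. N x \<le> m + t} \<in> sets \<mu>" "- {x. m - t \<le> N x} \<in> sets \<mu>"
      using meas[of "\<lambda>y. \<not> y \<le> m + t"] meas[of "\<lambda>y. \<not> m - t \<le> y"]
      by (simp_all add: Collect_neg_eq)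
    have "measure \<mu> {x. \<bar>N x - m\<bar> > t}
        \<le> measure \<mu> (- {x. N x \<le> m + t} \<union> - {x. m - t \<le> N x})"
      using ms by (intro finite_measure_mono) auto
    also have "\<dots> \<le> measure \<mu> (- {x. N x \<le> m + t}) + measure \<mu> (- {x. m - t \<le> N x})"
      using ms by (intro measure_Un_le)
    finally show ?thesis .
  qed
  ultimately show ?thesis by simp
qed

section \<open>From exponential tails to moments\<close>

lemma ennreal_le_suminf: "h k \<le> suminf h" for h :: "nat \<Rightarrow> ennreal"
  using sum_le_suminf[of h "{k}"] by simp

text \<open>The constant is optimal, as equality holds at \<open>x = 2 * p\<close>. The exponent \<open>x / 2\<close> is what an
  exponential tail \<open>exp (- q)\<close> can still integrate.\<close>

lemma powr_le_exp_half:
  assumes "0 \<le> x" "0 < (p::real)"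
  shows "x powr p \<le> (2 * p) powr p * exp (- p) * exp (x / 2)"
proof -
  have "x / (2 * p) \<le> exp (x / (2 * p) - 1)"
    using exp_ge_add_one_self[of "x / (2 * p) - 1"] by simp
  then have "(x / (2 * p)) powr p \<le> exp (x / (2 * p) - 1) powr p"
    using assms by (intro powr_mono2) auto
  also have "\<dots> = exp (- p) * exp (x / 2)"
    using assms by (simp add: powr_def field_simps flip: exp_add)
  finally show ?thesis using assms by (simp add: powr_divide field_simps)
qed

text \<open>Discrete layer-cake estimate: \<open>exp (g / 2)\<close> is at most \<open>exp (p / 2)\<close> up to level \<open>p\<close>, and
  above it at most \<open>exp ((p + k + 1) / 2)\<close> on the layer from \<open>p + k\<close> to \<open>p + k + 1\<close>, whose probability
  is at most \<open>exp (- (p + k))\<close>. The sum is a geometric series of ratio \<open>exp (- (1 / 2))\<close>. The bound \<open>exp p\<close>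
  is far from sharp, but it is exactly what cancels the factor \<open>exp (- p)\<close> in \<open>powr_le_exp_half\<close>.\<close>

lemma exp_half_moment:
  assumes "prob_space M" and [measurable]: "g \<in> borel_measurable M" and p: "2 \<le> (p::real)"
    and tail: "\<And>q. p \<le> q \<Longrightarrow> measure M {x \<in> space M. g x > q} \<le> exp (- q)"
  shows "(\<integral>\<^sup>+ x. ennreal (exp (g x / 2)) \<partial>M) \<le> ennreal (exp p)"
proof -
  interpret prob_space M by fact
  define s :: real where "s = exp (- (1 / 2))"
  have "3 / 2 \<le> exp (1 / 2 :: real)" using exp_ge_add_one_self[of "1 / 2 :: real"] by simp
  then have s: "0 < s" "s \<le> 2 / 3" by (simp_all add: s_def exp_minus field_simps)
  let ?A = "\<lambda>k. {x \<in> space M. g x > p + real k}"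
  let ?w = "\<lambda>k. exp ((p + real k + 1) / 2)"
  have layers: "ennreal (exp (g x / 2)) \<le> ennreal (exp (p / 2)) + (\<Sum>k. ennreal (?w k) * indicator (?A k) x)"
    if x: "x \<in> space M" for x
  proof (cases "g x \<le> p")
    case True
    then show ?thesis by (intro add_increasing2 ennreal_leI) auto
  next
    case False
    \<comment> \<open>The layers are open below and closed above, since the tail bound concerns strict excess.\<close>
    define k where "k = nat (\<lceil>g x - p\<rceil> - 1)"
    have "real k < g x - p" "g x - p \<le> real k + 1" using False unfolding k_def by linarith+
    then have k: "p + real k < g x" "g x \<le> p + real k + 1" by auto
    have "ennreal (exp (g x / 2)) \<le> ennreal (?w k) * indicator (?A k) x"
      using k x by (auto intro!: ennreal_leI)
    also have "\<dots> \<le> (\<Sum>k. ennreal (?w k) * indicator (?A k) x)"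
      by (rule ennreal_le_suminf)
    finally show ?thesis by (rule add_increasing[OF zero_le])
  qed
  have layer_mass: "ennreal (?w k) * emeasure M (?A k) \<le> ennreal (exp ((1 - p) / 2) * s ^ k)" for k
  proof -
    have "ennreal (?w k) * emeasure M (?A k) \<le> ennreal (?w k) * ennreal (exp (- (p + real k)))"
      unfolding emeasure_eq_measure using tail[of "p + real k"] by (intro mult_left_mono ennreal_leI) auto
    also have "\<dots> = ennreal (exp ((1 - p) / 2) * s ^ k)"
      by (simp add: s_def field_simps flip: ennreal_mult exp_add exp_of_nat_mult)
    finally show ?thesis .
  qed
  have "(\<integral>\<^sup>+ x. ennreal (exp (g x / 2)) \<partial>M)
      \<le> (\<integral>\<^sup>+ x. ennreal (exp (p / 2)) + (\<Sum>k. ennreal (?w k) * indicator (?A k) x) \<partial>M)"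
    by (intro nn_integral_mono layers)
  also have "\<dots> = ennreal (exp (p / 2)) + (\<Sum>k. ennreal (?w k) * emeasure M (?A k))"
    by (simp add: nn_integral_add nn_integral_suminf nn_integral_cmult emeasure_space_1)
  also have "\<dots> \<le> ennreal (exp (p / 2)) + (\<Sum>k. ennreal (exp ((1 - p) / 2) * s ^ k))"
    by (intro add_left_mono suminf_le layer_mass) auto
  also have "(\<Sum>k. ennreal (exp ((1 - p) / 2) * s ^ k)) = ennreal (exp ((1 - p) / 2) * (1 / (1 - s)))"
    using s by (intro suminf_ennreal_eq sums_mult geometric_sums) auto
  also have "ennreal (exp (p / 2)) + \<dots> = ennreal (exp (p / 2) + exp ((1 - p) / 2) * (1 / (1 - s)))"
    using s by (intro ennreal_plus[symmetric]) auto
  also have "\<dots> \<le> ennreal (exp p)"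
  proof (rule ennreal_leI)
    \<comment> \<open>After division by \<open>exp p\<close> both summands decrease in \<open>p\<close>, so the worst case is \<open>p = 2\<close>; with
      \<open>s \<le> 2 / 3\<close> they are then at most \<open>36 / 81\<close> and \<open>32 / 81\<close>.\<close>
    have "exp (p / 2) = exp p * exp (- (p / 2))" by (simp flip: exp_add)
    also have "\<dots> \<le> exp p * exp (- 1)" using p by simp
    also have "exp (- 1) = s ^ 2" by (simp add: s_def flip: exp_of_nat_mult)
    also have "exp p * s ^ 2 \<le> exp p * (2 / 3) ^ 2"
      using s by (intro mult_left_mono power_mono) auto
    finally have 1: "exp (p / 2) \<le> exp p * (4 / 9)" by (simp add: power2_eq_square)
    have "exp ((1 - p) / 2) = exp p * exp ((1 - 3 * p) / 2)" by (simp add: field_simps flip: exp_add)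
    also have "\<dots> \<le> exp p * exp (- (5 / 2))" using p by simp
    also have "exp (- (5 / 2)) = s ^ 5" by (simp add: s_def flip: exp_of_nat_mult)
    also have "exp p * s ^ 5 \<le> exp p * (2 / 3) ^ 5"
      using s by (intro mult_left_mono power_mono) auto
    finally have 2: "exp ((1 - p) / 2) \<le> exp p * (32 / 243)" by (simp add: power_divide)
    have "1 / (1 - s) \<le> 3" using s by (simp add: divide_le_eq)
    then have "exp ((1 - p) / 2) * (1 / (1 - s)) \<le> exp p * (32 / 243) * 3"
      using 2 s by (intro mult_mono) auto
    with 1 show "exp (p / 2) + exp ((1 - p) / 2) * (1 / (1 - s)) \<le> exp p"
      using exp_gt_zero[of p] by linarith
  qed
  finally show ?thesis .
qed

text \<open>After rescaling by \<open>c\<close>, \<open>powr_le_exp_half\<close> and \<open>exp_half_moment\<close> combine to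
  \<open>\<integral> (\<bar>f\<bar> / c) powr p \<le> (2 * p) powr p\<close>. To include \<open>c = 0\<close>, the rescaling uses a slightly larger
  \<open>d > 0\<close>, and the error is let tend to \<open>0\<close>.\<close>

lemma Lp_size_le_of_exponential_tail:
  assumes M: "prob_space M" and [measurable]: "f \<in> borel_measurable M" and p: "2 \<le> p" and c: "0 \<le> c"
    and tail: "\<And>q. p \<le> q \<Longrightarrow> measure M {x \<in> space M. \<bar>f x\<bar> > c * q} \<le> exp (- q)"
  shows "Lp_size M p f \<le> ennreal (2 * p * c)"
proof (rule ennreal_le_epsilon)
  interpret prob_space M by fact
  fix e :: real assume e: "0 < e"
  define d where "d = c + e / (2 * p)"
  have d: "0 < d" "c \<le> d" using e c p by (auto simp: d_def add_nonneg_pos)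
  have "(\<integral>\<^sup>+ x. ennreal (exp (\<bar>f x\<bar> / d / 2)) \<partial>M) \<le> ennreal (exp p)"
  proof (rule exp_half_moment[OF M _ p])
    fix q assume q: "p \<le> q"
    have "c * q \<le> d * q" using d q p by (intro mult_right_mono) auto
    then have "measure M {x \<in> space M. \<bar>f x\<bar> / d > q} \<le> measure M {x \<in> space M. \<bar>f x\<bar> > c * q}"
      using d by (intro finite_measure_mono) (auto simp: less_divide_eq mult.commute)
    with tail[OF q] show "measure M {x \<in> space M. \<bar>f x\<bar> / d > q} \<le> exp (- q)" by simp
  qed simp
  then have *: "ennreal ((2 * p * d) powr p * exp (- p)) * (\<integral>\<^sup>+ x. ennreal (exp (\<bar>f x\<bar> / d / 2)) \<partial>M)
      \<le> ennreal ((2 * p * d) powr p * exp (- p)) * ennreal (exp p)"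
    by (intro mult_left_mono) auto
  have "\<bar>f x\<bar> powr p \<le> (2 * p * d) powr p * exp (- p) * exp (\<bar>f x\<bar> / d / 2)" for x
  proof -
    have "\<bar>f x\<bar> powr p = d powr p * (\<bar>f x\<bar> / d) powr p"
      using d by (simp flip: powr_mult)
    also have "\<dots> \<le> d powr p * ((2 * p) powr p * exp (- p) * exp (\<bar>f x\<bar> / d / 2))"
      using d p by (intro mult_left_mono powr_le_exp_half) auto
    finally show ?thesis using d p by (simp add: powr_mult mult_ac)
  qed
  then have "(\<integral>\<^sup>+ x. ennreal (\<bar>f x\<bar> powr p) \<partial>M)
      \<le> (\<integral>\<^sup>+ x. ennreal ((2 * p * d) powr p * exp (- p)) * ennreal (exp (\<bar>f x\<bar> / d / 2)) \<partial>M)"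
    by (intro nn_integral_mono) (simp flip: ennreal_mult)
  also have "\<dots> \<le> ennreal ((2 * p * d) powr p * exp (- p)) * ennreal (exp p)"
    using * by (simp add: nn_integral_cmult)
  also have "\<dots> = ennreal ((2 * p * d) powr p)"
    by (simp add: mult.assoc flip: ennreal_mult exp_add)
  finally have "Lp_size M p f \<le> ennreal (2 * p * d)"
    using d p by (intro Lp_size_leI) auto
  also have "2 * p * d = 2 * p * c + e" using p by (simp add: d_def field_simps)
  also have "ennreal (2 * p * c + e) = ennreal (2 * p * c) + ennreal e"
    using p c e by (intro ennreal_plus) auto
  finally show "Lp_size M p f \<le> ennreal (2 * p * c) + ennreal e" .
qed

section \<open>Comparison of weak and strong moments\<close>

theorem proposition3p12:
  fixes \<mu> :: "(real ^ 'n) measure"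
    and \<alpha> \<beta> p m :: real
    and N :: "real ^ 'n \<Rightarrow> real"
  assumes "prob_space \<mu>" and "sets \<mu> = sets borel"
    and "regular_measure \<alpha> \<mu>"
    and "CI \<beta> \<mu>"
    and "is_norm N"
    and "is_median \<mu> N m"
    and "p \<ge> 2"
  shows "Lp_size \<mu> p (\<lambda>x. N x - m)
           \<le> ennreal (2 * \<alpha> * \<beta>) * (SUP u\<in>{u. dual_norm N u \<le> 1}. Lp_size \<mu> p (\<lambda>x. u \<bullet> x))"
proof -
  define w where "w q = (SUP u\<in>{u. dual_norm N u \<le> 1}. Lp_size \<mu> q (\<lambda>x. u \<bullet> x))" for q
  have \<beta>: "0 < \<beta>" using assms(4) by (simp add: CI_def)
  have sp: "space \<mu> = UNIV" using sets_eq_imp_space_eq[OF assms(2)] by simp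
  have [measurable]: "N \<in> borel_measurable \<mu>"
    using borel_measurable_continuous_onI[OF is_norm_continuous_on[OF assms(5)]] assms(2)
    by (simp cong: measurable_cong_sets)
  show ?thesis
  proof (cases "ennreal \<alpha> * w p")
    \<comment> \<open>The product is finite also when \<open>\<alpha> \<le> 0\<close>, whatever \<open>w p\<close> is, because \<open>0 * \<infinity> = 0\<close>; then \<open>K = 0\<close>
      and the same argument shows that the left-hand side vanishes.\<close>
    case (real K)
    have scale: "ennreal (\<alpha> * c) * w p = ennreal (c * K)" if "0 \<le> c" for c
    proof -
      have "ennreal (\<alpha> * c) * w p = ennreal c * (ennreal \<alpha> * w p)"
        using that by (simp add: ennreal_mult'' mult_ac)
      also have "\<dots> = ennreal (c * K)" using that real by (simp add: ennreal_mult)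
      finally show ?thesis .
    qed
    have w_le: "w q \<le> ennreal (q / p * K)" if q: "p \<le> q" for q
    proof -
      have "Lp_size \<mu> q (\<lambda>x. u \<bullet> x) \<le> ennreal (\<alpha> * (q / p)) * w p" if "dual_norm N u \<le> 1" for u
      proof -
        have "Lp_size \<mu> q (\<lambda>x. u \<bullet> x) \<le> ennreal (\<alpha> * (q / p)) * Lp_size \<mu> p (\<lambda>x. u \<bullet> x)"
          using assms(3,7) q by (simp add: regular_measure_def)
        also have "\<dots> \<le> ennreal (\<alpha> * (q / p)) * w p"
          unfolding w_def using that by (intro mult_left_mono SUP_upper) auto
        finally show ?thesis .
      qed
      then have "w q \<le> ennreal (\<alpha> * (q / p)) * w p"
        unfolding w_def[of q] by (intro SUP_least) auto
      then show ?thesis using scale[of "q / p"] q assms(7) by simp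
    qed
    have "measure \<mu> {x \<in> space \<mu>. \<bar>N x - m\<bar> > \<beta> * K / p * q} \<le> exp (- q)" if q: "p \<le> q" for q
    proof -
      have "\<beta> * N z \<le> \<beta> * K / p * q" if z: "z \<in> Z_body q \<mu>" for z
      proof -
        have "ennreal (N z) \<le> ennreal (q / p * K)"
          using norm_le_on_Z_body[OF assms(5) _ z] w_le[OF q] q assms(7)
          unfolding w_def by (meson order_trans less_le_trans zero_less_numeral)
        then have "N z \<le> q / p * K" using real q assms(7) by (simp add: ennreal_le_iff)
        then show ?thesis using mult_left_mono[of "N z" "q / p * K" \<beta>] \<beta> by (simp add: mult_ac)
      qed
      then show ?thesis
        using CI_deviation[OF assms(1,2,4,5,6), of q] q assms(7) sp by simp
    qed
    then have "Lp_size \<mu> p (\<lambda>x. N x - m) \<le> ennreal (2 * p * (\<beta> * K / p))"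
      using assms(1,7) \<beta> real by (intro Lp_size_le_of_exponential_tail) auto
    also have "2 * p * (\<beta> * K / p) = 2 * \<beta> * K" using assms(7) by simp
    also have "ennreal (2 * \<beta> * K) = ennreal (2 * \<alpha> * \<beta>) * w p"
      using scale[of "2 * \<beta>"] \<beta> by (simp add: mult_ac)
    finally show ?thesis by (simp add: w_def)
  next
    case top
    then have "w p = top" "0 < \<alpha>"
      by (auto simp: ennreal_mult_eq_top_iff ennreal_eq_0_iff not_le)
    then have "ennreal (2 * \<alpha> * \<beta>) * w p = top"
      using \<beta> by (simp add: ennreal_mult_eq_top_iff ennreal_eq_0_iff not_le)
    then show ?thesis by (simp add: w_def)
  qed
qed

end
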